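(* Let $S\in(0,1)$ be an elementary slope. Then $S$ is rational. Moreover, writing $S=\frac{p}{q}$ as an irreducible fraction with $p,q$ positive integers, $p$ is either $1$ or a multiple of $3$, and if $p\neq 1$, then $q$ is congruent to either $1$ or $p-1$ modulo $p$.
   Context: $\mathbb{N}=\{0,1,2,\dots\}$. Breakout system. The domain is $\mathbb{R}^2$ and initially all the unit bricks $[x,x+1]\times[y,y+1]$, $(x,y)\in\mathbb{Z}^2\setminus\{(-1,0)\}$, are present. A ball is launched from $(0,y_0)$, $0<y_0<1$, in a direction with two positive coordinates and slope $S\in(0,1)$. It moves in a straight line; each time it hits an edge of a brick still present, it is reflected as in a billiard and that brick is destroyed (so at time $0$ the brick $[0,1]\times[0,1]$ is hit on its left vertical edge and destroyed, and the ball leaves towards decreasing abscissas). For $n\in\mathbb{N}$, $T_x(n)$ denotes the abscissa of the ball after it has traveled a total horizontal distance $n$ (it is an integer), and $T_y(n)=T_y(0)+Sn$ with $T_y(0)=y_0$ (the unfolded ordinate: a hit on a horizontal edge is regarded as reflecting both the remaining bricks and the trajectory along that edge, so the ordinate keeps increasing and the abscissas are unchanged). Orbits are always assumed not to meet $\mathbb{Z}^2$, i.e. $T_y(n)\notin\mathbb{Z}$ for all $n\in\mathbb{N}$. Slicing sequence. For a slope $S$ and $T_y(0)\in(0,S)$, the slicing sequence $(\chi_n)_{n\in\mathbb{N}}$ is the sequence of positive integers determined by $T_y(0)+S\sum_{0\le n\le N}\chi_n\in(N+1,N+1+S)$ for all $N\in\mathbb{N}$. Blocks. For $(\alpha,\rho)\in\mathbb{N}^2$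 with $0\le\rho\le\alpha$ put $|\alpha,\rho|=\frac{\alpha(\alpha+1)}{2}+\rho+1$ (each positive integer is uniquely of this form) and $X(|\alpha,\rho|)=\left(\sum_{0<n\le\alpha}(-1)^n n\right)+(-1)^{\alpha+1}(\rho+1)$. A ternary block is a triple $\Delta=((\alpha_i,\rho_i))_{0\le i\le 2}$ of such pairs for which there exist $S\in(0,1)$ and $y\in(0,S)$ with $i+1<y+S|\alpha_i,\rho_i|<i+1+S$ for $i=0,1,2$. Put $|\Delta|=|\alpha_2,\rho_2|$. The block is also written $\Delta=(\chi_0,\chi_1,\chi_2)$ where $\chi_0=|\alpha_0,\rho_0|$, $\chi_1=|\alpha_1,\rho_1|-|\alpha_0,\rho_0|$, $\chi_2=|\alpha_2,\rho_2|-|\alpha_1,\rho_1|$. A ternary block is elementary if: either $\alpha_0,\alpha_2$ have the same parity and $\alpha_2-2\rho_2=\alpha_0-2\rho_0$, or $\alpha_0,\alpha_2$ have different parities and $\alpha_2-2\rho_2=-\alpha_0+2\rho_0+1$. Elementary slopes. A slope $S\in(0,1)$ is elementary, with elementary sequence $(\Delta_n)_{n\in\mathbb{N}}$, if every $\Delta_n=((\alpha_{i,n},\rho_{i,n}))_{0\le i\le 2}$ is an elementary block and there is an orbit of slope $S$ with initial ordinate $T_y(0)\in(0,S)$, with slicing sequence $(\chi_n)$, such that $\Delta_n=(\chi_{3n},\chi_{3n+1},\chi_{3n+2})$ for all $n$ and, for all $N\in\mathbb{N}$ and $0\le i\le 2$, $$T_x(\Sigma_N+|\alpha_{i,N},\rho_{i,N}|)=T_x(\Sigma_N)+(-1)^{\alpha_N}X(|\alpha_{i,N},\rho_{i,N}|),$$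 where $\alpha_N=\sum_{0\le j<N}(\alpha_{2,j}+1)$ and $\Sigma_N=\sum_{0\le j<N}|\Delta_j|$. *)

theory Defs
  imports "HOL-Analysis.Product_Vector" "HOL-Number_Theory.Cong"
begin

section \<open>The Breakout system\<close>

text \<open>A pair \<open>(a, b)\<close> of integers stands for the brick \<open>[a, a+1] \<times> [b, b+1]\<close>.\<close>

type_synonym brick = "int \<times> int"

definition vertical_edges :: "brick \<Rightarrow> (real \<times> real) set" where
  "vertical_edges = (\<lambda>(a, b). {of_int a, of_int a + 1} \<times> {of_int b .. of_int b + 1})"

definition horizontal_edges :: "brick \<Rightarrow> (real \<times> real) set" where
  "horizontal_edges = (\<lambda>(a, b). {of_int a .. of_int a + 1} \<times> {of_int b, of_int b + 1})"

text \<open>The ball moves in the actual (folded) plane. Its velocity is \<open>(\<plusminus>1, \<plusminus>S)\<close>, so that elapsed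
  time and travelled horizontal distance are the same thing.\<close>

record breakout =
  pos :: "real \<times> real"
  vel :: "real \<times> real"
  bricks :: "brick set"
  travelled :: real

definition launch :: "real \<Rightarrow> real \<Rightarrow> breakout" where
  "launch S y\<^sub>0 = \<lparr>pos = (0, y\<^sub>0), vel = (1, S), bricks = UNIV - {(-1, 0)}, travelled = 0\<rparr>"

text \<open>The value \<open>0\<close> is allowed: it occurs for the hit at time \<open>0\<close>. Just after a hit, the ball sits
  on an edge shared by the brick just destroyed and by an empty cell, so that the same
  position is not counted a second time.\<close>

definition time_to_hit :: "breakout \<Rightarrow> real" where
  "time_to_hit s = (LEAST t. 0 \<le> t \<and>
     (\<exists>b \<in> bricks s. pos s + t *\<^sub>R vel s \<in> vertical_edges b \<union> horizontal_edges b))"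

text \<open>Move to the next hit, reflect, and destroy the brick that is hit. For a trajectory avoiding the
  integer lattice, every hit occurs in the relative interior of an edge; hence exactly one brick
  is destroyed and exactly one component of the velocity is negated.\<close>

definition hit :: "breakout \<Rightarrow> breakout" where
  "hit s =
    (let t = time_to_hit s;
         p = pos s + t *\<^sub>R vel s;
         (u, v) = vel s
     in \<lparr>pos = p,
         vel = (if \<exists>b \<in> bricks s. p \<in> vertical_edges b then - u else u,
                if \<exists>b \<in> bricks s. p \<in> horizontal_edges b then - v else v),
         bricks = bricks s - {b. p \<in> vertical_edges b \<union> horizontal_edges b},
         travelled = travelled s + t\<rparr>)"

definition after_hits :: "real \<Rightarrow> real \<Rightarrow> nat \<Rightarrow> breakout" where
  "after_hits S y\<^sub>0 k = (hit ^^ k) (launch S y\<^sub>0)"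

definition abscissa :: "real \<Rightarrow> real \<Rightarrow> real \<Rightarrow> real" where
  "abscissa S y\<^sub>0 t = (THE x. \<exists>k. let s = after_hits S y\<^sub>0 k in
     travelled s \<le> t \<and> t \<le> travelled (after_hits S y\<^sub>0 (Suc k)) \<and>
     x = fst (pos s + (t - travelled s) *\<^sub>R vel s))"

definition T_x :: "real \<Rightarrow> real \<Rightarrow> nat \<Rightarrow> real" where
  "T_x S y\<^sub>0 n = abscissa S y\<^sub>0 (real n)"

text \<open>The unfolded ordinate: hits on horizontal edges reflect the bricks instead of the
  trajectory. This unfolding leaves abscissas unchanged, so \<open>T_x\<close> may be read off in the
  folded plane.\<close>

definition T_y :: "real \<Rightarrow> real \<Rightarrow> nat \<Rightarrow> real" where
  "T_y S y\<^sub>0 n = y\<^sub>0 + S * real n"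

definition orbit :: "real \<Rightarrow> real \<Rightarrow> bool" where
  "orbit S y\<^sub>0 \<longleftrightarrow> 0 < S \<and> S < 1 \<and> 0 < y\<^sub>0 \<and> y\<^sub>0 < 1 \<and> (\<forall>n. T_y S y\<^sub>0 n \<notin> \<int>)"

definition slicing_sequence :: "real \<Rightarrow> real \<Rightarrow> (nat \<Rightarrow> nat) \<Rightarrow> bool" where
  "slicing_sequence S y\<^sub>0 \<chi> \<longleftrightarrow> (\<forall>n. 0 < \<chi> n) \<and>
     (\<forall>N. y\<^sub>0 + S * real (\<Sum>n\<le>N. \<chi> n) \<in> {real N + 1 <..< real N + 1 + S})"

section \<open>Ternary blocks\<close>

text \<open>\<open>pair_size (\<alpha>, \<rho>)\<close> is \<open>|\<alpha>, \<rho>|\<close>. Since \<open>(\<alpha>, \<rho>)\<close> with \<open>\<rho> \<le> \<alpha>\<close> is determined by \<open>|\<alpha>, \<rho>|\<close>, the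
  quantity \<open>X(|\<alpha>, \<rho>|)\<close> is given as a function \<open>pair_X\<close> of the pair.\<close>

definition pair_size :: "nat \<times> nat \<Rightarrow> nat" where
  "pair_size = (\<lambda>(\<alpha>, \<rho>). \<alpha> * (\<alpha> + 1) div 2 + \<rho> + 1)"

definition pair_X :: "nat \<times> nat \<Rightarrow> int" where
  "pair_X = (\<lambda>(\<alpha>, \<rho>). (\<Sum>n\<in>{0<..\<alpha>}. (-1) ^ n * int n) + (-1) ^ (\<alpha> + 1) * (int \<rho> + 1))"

text \<open>A triple of pairs is represented by a function of which only the values at
  \<open>0\<close>, \<open>1\<close>, \<open>2\<close> matter.\<close>

type_synonym block = "nat \<Rightarrow> nat \<times> nat"

definition ternary_block :: "block \<Rightarrow> bool" where
  "ternary_block \<Delta> \<longleftrightarrow> (\<forall>i\<le>2. snd (\<Delta> i) \<le> fst (\<Delta> i)) \<and>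
     (\<exists>S y :: real. 0 < S \<and> S < 1 \<and> 0 < y \<and> y < S \<and>
        (\<forall>i\<le>2. real i + 1 < y + S * real (pair_size (\<Delta> i)) \<and>
               y + S * real (pair_size (\<Delta> i)) < real i + 1 + S))"

definition block_size :: "block \<Rightarrow> nat" where
  "block_size \<Delta> = pair_size (\<Delta> 2)"

text \<open>The subtraction is never truncated for a ternary block, whose three sizes increase.\<close>

definition block_chi :: "block \<Rightarrow> nat \<Rightarrow> nat" where
  "block_chi \<Delta> i = (if i = 0 then pair_size (\<Delta> 0) else pair_size (\<Delta> i) - pair_size (\<Delta> (i - 1)))"

definition elementary_block :: "block \<Rightarrow> bool" where
  "elementary_block \<Delta> \<longleftrightarrow> ternary_block \<Delta> \<and>
     (let (\<alpha>\<^sub>0, \<rho>\<^sub>0) = \<Delta> 0; (\<alpha>\<^sub>2, \<rho>\<^sub>2) = \<Delta> 2 in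
        (even \<alpha>\<^sub>0 \<longleftrightarrow> even \<alpha>\<^sub>2) \<and> int \<alpha>\<^sub>2 - 2 * int \<rho>\<^sub>2 = int \<alpha>\<^sub>0 - 2 * int \<rho>\<^sub>0 \<or>
        \<not> (even \<alpha>\<^sub>0 \<longleftrightarrow> even \<alpha>\<^sub>2) \<and> int \<alpha>\<^sub>2 - 2 * int \<rho>\<^sub>2 = - int \<alpha>\<^sub>0 + 2 * int \<rho>\<^sub>0 + 1)"

section \<open>Elementary slopes\<close>

definition elementary_sequence :: "real \<Rightarrow> (nat \<Rightarrow> block) \<Rightarrow> bool" where
  "elementary_sequence S \<Delta> \<longleftrightarrow> (\<forall>n. elementary_block (\<Delta> n)) \<and>
     (\<exists>y\<^sub>0 \<chi>. orbit S y\<^sub>0 \<and> y\<^sub>0 < S \<and> slicing_sequence S y\<^sub>0 \<chi> \<and>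
        (\<forall>n. \<forall>i\<le>2. \<chi> (3 * n + i) = block_chi (\<Delta> n) i) \<and>
        (\<forall>N. \<forall>i\<le>2.
           (let \<alpha> = (\<Sum>j<N. fst (\<Delta> j 2) + 1); \<Sigma> = (\<Sum>j<N. block_size (\<Delta> j)) in
            T_x S y\<^sub>0 (\<Sigma> + pair_size (\<Delta> N i)) =
              T_x S y\<^sub>0 \<Sigma> + (-1) ^ \<alpha> * of_int (pair_X (\<Delta> N i)))))"

definition elementary_slope :: "real \<Rightarrow> bool" where
  "elementary_slope S \<longleftrightarrow> 0 < S \<and> S < 1 \<and> (\<exists>\<Delta>. elementary_sequence S \<Delta>)"

end

theory Submission
  imports Defs "HOL-Analysis.Kronecker_Approximation_Theorem"
begin

text \<open>Put \<open>\<beta> = 1 / S = k + \<theta>\<close> with \<open>k\<close> an integer and \<open>0 \<le> \<theta> < 1\<close>. The remainders left by the slicing sequence,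
  divided by \<open>S\<close>, follow the rotation by \<open>-\<beta>\<close> on the circle, so the \<open>n\<close>-th block is determined by
  the \<open>n\<close>-th point \<open>t\<close> of an orbit of the rotation by \<open>-3\<beta>\<close>: its first term is the integer
  \<open>c \<in> (\<beta> - t, \<beta> - t + 1)\<close> and its sum is the integer \<open>s \<in> (3\<beta> - t, 3\<beta> - t + 1)\<close>. Being elementary
  depends on the pair \<open>(c, s)\<close> alone, and is a Diophantine condition on it: with \<open>2c = A\<^sup>2 - u + 1\<close>
  and \<open>2s = B\<^sup>2 - v + 1\<close>, where \<open>A = \<alpha>\<^sub>0 + 1\<close>, \<open>u = \<alpha>\<^sub>0 - 2\<rho>\<^sub>0\<close> and similarly for \<open>B\<close> and \<open>v\<close>, it reads
  \<open>v = u\<close> or \<open>v = 1 - u\<close> according to whether \<open>A + B\<close> is even or odd. A computation modulo \<open>4\<close> shows that \<open>A + B\<close> and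
  \<open>s + c\<close> have the same parity.

  Passing from a number to the next one changes these coordinates in a rigid way, and three couples of
  pairs turn out to be mutually exclusive: \<open>(k, 3k)\<close> with \<open>(k, 3k + 1)\<close>, then \<open>(l, 3l)\<close> with
  \<open>(l, 3l - 1)\<close> for \<open>l = k + 1\<close>, and finally \<open>(k, 3k + 1)\<close> with \<open>(k + 1, 3k + 2)\<close>. These
  couples occur on explicit intervals of the circle when \<open>\<theta>\<close> lies in \<open>(0, 1/3)\<close>,
  \<open>(2/3, 1)\<close> and \<open>(1/3, 2/3)\<close>, respectively, so the orbit cannot visit both intervals
  of the relevant couple (lemma \<open>elementary_gaps\<close>).

  If \<open>S\<close> is irrational the orbit is dense and visits every interval: contradiction. If \<open>S = p / q\<close>
  in lowest terms, the orbit visits every half-open interval of length \<open>gcd 3 p / p\<close>. All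
  the intervals have lengths that are multiples of \<open>1 / p\<close>, so when \<open>3\<close> does not divide \<open>p\<close> only
  \<open>\<theta> = 0\<close> remains, that is \<open>p = 1\<close>. When \<open>3\<close> divides \<open>p\<close>, one of the intervals must be shorter
  than \<open>3 / p\<close>, or \<open>\<theta>\<close> is \<open>1/3\<close> or \<open>2/3\<close>; both force \<open>q mod p\<close> to be \<open>1\<close> or \<open>p - 1\<close>.\<close>

section \<open>Arithmetic of elementary blocks\<close>

text \<open>Doubling \<open>|\<alpha>, \<rho>|\<close> and completing the square in \<open>A = \<alpha> + 1\<close> leaves the term
  \<open>u = \<alpha> - 2\<rho>\<close>, which is the quantity that the definition of an elementary block compares. The bounds and the
  parity condition on \<open>u\<close> express \<open>0 \<le> \<rho> \<le> \<alpha>\<close> for an integer \<open>\<rho>\<close>.\<close>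

definition tri_coords :: "int \<Rightarrow> int \<Rightarrow> int \<Rightarrow> bool" where
  "tri_coords n A u \<longleftrightarrow> \<bar>u\<bar> < A \<and> odd (A + u) \<and> 2 * n = A\<^sup>2 - u + 1"

lemma tri_coords_pair_size:
  assumes "\<rho> \<le> \<alpha>"
  shows "tri_coords (int (pair_size (\<alpha>, \<rho>))) (int \<alpha> + 1) (int \<alpha> - 2 * int \<rho>)"
proof -
  have "2 * (\<alpha> * (\<alpha> + 1) div 2) = \<alpha> * (\<alpha> + 1)"
    by simp
  then have "2 * int (\<alpha> * (\<alpha> + 1) div 2) = int \<alpha> * (int \<alpha> + 1)"
    by (metis of_nat_1 of_nat_add of_nat_mult of_nat_numeral)
  moreover have "int (pair_size (\<alpha>, \<rho>)) = int (\<alpha> * (\<alpha> + 1) div 2) + int \<rho> + 1"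
    unfolding pair_size_def by simp
  ultimately have "2 * int (pair_size (\<alpha>, \<rho>)) = int \<alpha> * (int \<alpha> + 1) + 2 * int \<rho> + 2"
    by linarith
  then show ?thesis
    using assms unfolding tri_coords_def by (auto simp: power2_eq_square algebra_simps)
qed

lemma tri_coords_bounds:
  assumes "tri_coords n A u"
  shows "A * (A - 1) < 2 * n" "2 * n \<le> A * (A + 1)" "0 < A"
  using assms unfolding tri_coords_def by (auto simp: power2_eq_square algebra_simps)

text \<open>The numbers with first coordinate \<open>A\<close> fill the gap \<open>(A(A - 1)/2, A(A + 1)/2]\<close> between consecutive triangular numbers.\<close>

lemma tri_coords_mono:
  assumes "tri_coords n A u" "tri_coords m B v" "n \<le> m"
  shows "A \<le> B"
proof (rule ccontr)
  assume "\<not> A \<le> B"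
  then have "(B + 1) * B \<le> A * (A - 1)"
    using tri_coords_bounds(3)[OF assms(2)] by (intro mult_mono) auto
  with tri_coords_bounds[OF assms(1)] tri_coords_bounds[OF assms(2)] assms(3) show False
    by (simp add: mult.commute)
qed

lemma tri_coords_unique:
  assumes "tri_coords n A u" "tri_coords n B v"
  shows "A = B \<and> u = v"
proof -
  have "A = B"
    using tri_coords_mono[OF assms] tri_coords_mono[OF assms(2,1)] by simp
  with assms show ?thesis
    unfolding tri_coords_def by auto
qed

lemma tri_coords_Suc:
  assumes "tri_coords n A u"
  shows "if u = 1 - A then tri_coords (n + 1) (A + 1) A else tri_coords (n + 1) A (u - 2)"
  using assms unfolding tri_coords_def
  by (auto simp: power2_eq_square algebra_simps) presburger+

text \<open>The successor of a number either stays in the same gap between triangular numbers, lowering \<open>u\<close> by \<open>2\<close>, or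
  is the first number of the next gap; the latter happens exactly at a triangular number.\<close>

lemma tri_coords_next:
  assumes "tri_coords n A u" "tri_coords (n + 1) B v"
  shows "B = A \<and> v = u - 2 \<or> B = A + 1 \<and> u = 1 - A \<and> v = A"
  using tri_coords_Suc[OF assms(1)] tri_coords_unique[OF assms(2)] by (auto split: if_splits)

definition elementary_pair :: "int \<Rightarrow> int \<Rightarrow> bool" where
  "elementary_pair c s \<longleftrightarrow> (\<exists>A u B v. tri_coords c A u \<and> tri_coords s B v \<and>
     (if even (A + B) then v = u else v = 1 - u))"

text \<open>In an elementary pair the parity of \<open>A + B\<close> can be read off from the numbers: substituting \<open>v\<close> gives
  \<open>2(s + c) = A\<^sup>2 + B\<^sup>2 - 2u + 2\<close> if \<open>A + B\<close> is even and \<open>2(s + c) = A\<^sup>2 + B\<^sup>2 + 1\<close> if it is odd.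
  The first right-hand side is divisible by \<open>4\<close>, because \<open>A + u\<close> is odd, and the second one is \<open>2\<close> modulo \<open>4\<close>.\<close>

lemma elementary_pairE:
  assumes "elementary_pair c s"
  obtains A u B v where "tri_coords c A u" "tri_coords s B v"
    "even (A + B) \<longleftrightarrow> even (s + c)" "v = (if even (s + c) then u else 1 - u)"
proof -
  obtain A u B v where *: "tri_coords c A u" "tri_coords s B v"
     "if even (A + B) then v = u else v = 1 - u"
    using assms unfolding elementary_pair_def by blast
  have odds: "odd (A + u)" "odd (B + v)" and c: "2 * c = A\<^sup>2 - u + 1" and s: "2 * s = B\<^sup>2 - v + 1"
    using * by (auto simp: tri_coords_def)
  have "even (A + B) \<longleftrightarrow> even (s + c)"
  proof (cases "even (A + B)")
    case True
    then obtain d where d: "B = A + 2 * d"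
      by (metis add_diff_cancel_left' dvdE even_diff add.commute diff_add_cancel)
    obtain h where h: "A + u = 2 * h + 1"
      using odds(1) by (elim oddE)
    obtain w where w: "A\<^sup>2 + A = 2 * w"
      by (metis dvd_def even_add even_power zero_neq_numeral pos2)
    have "2 * (s + c) = 2 * A\<^sup>2 + 4 * A * d + 4 * d\<^sup>2 - 2 * u + 2"
      using True c s *(3) d by (simp add: power2_eq_square algebra_simps)
    also have "\<dots> = 2 * (2 * (A * d + d\<^sup>2) + (A\<^sup>2 + A) - (A + u) + 1)"
      by (simp add: algebra_simps)
    finally have "s + c = 2 * (A * d + d\<^sup>2 + w - h)"
      unfolding h w by simp
    then show ?thesis
      using True by simp
  next
    case False
    then obtain d where d: "B = A + 2 * d + 1"
      by (metis oddE even_diff add.commute diff_add_cancel add.assoc)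
    have v: "v = 1 - u"
      using False *(3) by simp
    have "2 * (s + c) = 2 * A\<^sup>2 + 2 * A + 4 * (A * d + d\<^sup>2 + d) + 2"
      unfolding distrib_left c s v d by (simp add: power2_eq_square algebra_simps)
    then have "s + c = A\<^sup>2 + A + 2 * (A * d + d\<^sup>2 + d) + 1"
      by simp
    then have "odd (s + c)"
      by simp
    then show ?thesis
      using False by simp
  qed
  then show ?thesis
    using * that by (auto split: if_splits)
qed

text \<open>The sums \<open>3c\<close> and \<open>3c + 1\<close> need values of \<open>B\<close> of different parities, so \<open>3c\<close> is a triangular
  number, where \<open>u = v = 1 - B\<close> is as small as possible. As \<open>|u| < A\<close>, this forces \<open>B \<le> A\<close>, whereas
  \<open>B\<close> should be about \<open>\<surd>3\<close> times \<open>A\<close>. The next lemma rests on the same idea.\<close>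

lemma not_elementary_pair_3_and_Suc:
  assumes "elementary_pair c (3 * c)" "elementary_pair c (3 * c + 1)"
  shows False
proof -
  obtain A u B where c: "tri_coords c A u" and s: "tri_coords (3 * c) B u" and e: "even (A + B)"
    using assms(1) by (elim elementary_pairE) auto
  obtain A' u' B' where c': "tri_coords c A' u'" and s': "tri_coords (3 * c + 1) B' (1 - u')"
    and o: "odd (A' + B')"
    using assms(2) by (elim elementary_pairE) auto
  have [simp]: "A' = A" "u' = u"
    using tri_coords_unique[OF c c'] by auto
  have "u = 1 - B"
    using tri_coords_next[OF s s'] e o by auto
  then have "B\<^sup>2 - 2 * B = 3 * A\<^sup>2" and le: "B \<le> A" and "0 < B"
    using c s by (auto simp: tri_coords_def)
  moreover have "B\<^sup>2 \<le> A\<^sup>2"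
    using le \<open>0 < B\<close> by (intro power_mono) auto
  moreover have "0 < A\<^sup>2"
    using le \<open>0 < B\<close> by auto
  ultimately show False
    by linarith
qed

lemma not_elementary_pair_3_and_pred:
  assumes "elementary_pair c (3 * c)" "elementary_pair c (3 * c - 1)"
  shows False
proof -
  obtain A u B where c: "tri_coords c A u" and s: "tri_coords (3 * c) B u" and e: "even (A + B)"
    using assms(1) by (elim elementary_pairE) auto
  obtain A' u' B' where c': "tri_coords c A' u'" and s': "tri_coords (3 * c - 1) B' (1 - u')"
    and o: "odd (A' + B')"
    using assms(2) by (elim elementary_pairE) auto
  have [simp]: "A' = A" "u' = u"
    using tri_coords_unique[OF c c'] by auto
  have "B = B' + 1" "u = B'"
    using tri_coords_next[OF s'] s e o by auto
  then have "B'\<^sup>2 + 4 * B' = 3 * A\<^sup>2 + 1" and le: "B' + 1 \<le> A" and "0 < B'"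
    using c s s' by (auto simp: tri_coords_def power2_eq_square algebra_simps)
  moreover have "B'\<^sup>2 + 2 * B' + 1 \<le> A\<^sup>2"
    using power_mono[of "B' + 1" A 2] le \<open>0 < B'\<close> by (simp add: power2_sum)
  moreover have "0 < B'\<^sup>2"
    using \<open>0 < B'\<close> by auto
  ultimately show False
    by linarith
qed

text \<open>Both pairs have an odd sum \<open>s + c\<close>, so \<open>v = 1 - u\<close> in each: passing from the first to the second, the
  changes of \<open>u\<close> and \<open>v\<close> must add up to \<open>0\<close>. But each of them is either \<open>-2\<close> or an odd positive number.\<close>

lemma not_elementary_pair_consecutive:
  assumes "elementary_pair k (3 * k + 1)" "elementary_pair (k + 1) (3 * k + 2)"
  shows False
proof -
  obtain A u B where c: "tri_coords k A u" and s: "tri_coords (3 * k + 1) B (1 - u)"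
    using assms(1) by (elim elementary_pairE) auto
  obtain A' u' B' where c': "tri_coords (k + 1) A' u'" and s': "tri_coords (3 * k + 2) B' (1 - u')"
    using assms(2) by (elim elementary_pairE) auto
  have B: "B' = B \<and> 1 - u' = - 1 - u \<or> B' = B + 1 \<and> 1 - u = 1 - B \<and> 1 - u' = B"
    using tri_coords_next[OF s, of B' "1 - u'"] s' by (auto simp: add.commute)
  have A: "A' = A \<and> u' = u - 2 \<or> A' = A + 1 \<and> u = 1 - A \<and> u' = A"
    by (rule tri_coords_next[OF c c'])
  have pos: "0 < A" "0 < B"
    using tri_coords_bounds(3) c s by auto
  show False
    using A B pos by presburger
qed


section \<open>Blocks along an orbit\<close>

text \<open>Some block whose point \<open>t\<close> of the rotation lies in \<open>[a, b)\<close> is elementary. The strict bounds determine \<open>c\<close> and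
  \<open>s\<close> from \<open>t\<close>; they say that the next point of the orbit, and the third next, are interior to the unit
  interval.\<close>

definition elementary_block_in :: "real \<Rightarrow> real \<Rightarrow> real \<Rightarrow> bool" where
  "elementary_block_in \<beta> a b \<longleftrightarrow> (\<exists>(t::real) (c::int) (s::int). a \<le> t \<and> t < b \<and> 0 < t \<and> t < 1 \<and>
     \<beta> - t < c \<and> c < \<beta> - t + 1 \<and> 3 * \<beta> - t < s \<and> s < 3 * \<beta> - t + 1 \<and> elementary_pair c s)"

text \<open>The bounds say that \<open>[a, b)\<close> lies between consecutive breakpoints of the step functions \<open>t \<mapsto> c\<close> and \<open>t \<mapsto> s\<close>, so
  every \<open>t\<close> in it gives the same pair.\<close>

lemma elementary_block_inD:
  fixes c s :: int and a b \<beta> :: real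
  assumes "elementary_block_in \<beta> a b"
    and "\<beta> - a \<le> c" "c \<le> \<beta> - b + 1" "3 * \<beta> - a \<le> s" "s \<le> 3 * \<beta> - b + 1"
  shows "elementary_pair c s"
proof -
  obtain t and c' s' :: int where t: "a \<le> t" "t < b" "\<beta> - t < c'" "c' < \<beta> - t + 1"
    "3 * \<beta> - t < s'" "s' < 3 * \<beta> - t + 1" and e: "elementary_pair c' s'"
    using assms(1) unfolding elementary_block_in_def by blast
  have "real_of_int c' < c + 1" "real_of_int c < c' + 1" "real_of_int s' < s + 1" "real_of_int s < s' + 1"
    using t assms(2-5) by linarith+
  then have "c' = c" "s' = s"
    by linarith+
  with e show ?thesis
    by simp
qed

text \<open>The partition of the circle according to \<open>(c, s)\<close>: for \<open>\<theta> < 1/3\<close> the pairs \<open>(k, 3k + 1)\<close> and \<open>(k, 3k)\<close>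
  occupy \<open>[\<theta>, 3\<theta>)\<close> and \<open>[3\<theta>, 1)\<close>; for \<open>\<theta> > 2/3\<close> the pairs \<open>(k + 1, 3k + 3)\<close> and \<open>(k + 1, 3k + 2)\<close> occupy
  \<open>[0, 3\<theta> - 2)\<close> and \<open>[3\<theta> - 2, \<theta>)\<close>; in between, \<open>(k + 1, 3k + 2)\<close> and \<open>(k, 3k + 1)\<close> occupy the initial
  segment up to \<open>min \<theta> (3\<theta> - 1)\<close> and the final segment from \<open>max \<theta> (3\<theta> - 1)\<close>. If every interval of length
  \<open>\<delta>\<close> is visited, two exclusive pairs cannot both occupy that much room.\<close>

lemma elementary_gaps:
  fixes k :: int and \<theta> \<delta> :: real
  assumes \<delta>: "\<And>a. 0 \<le> a \<Longrightarrow> a + \<delta> \<le> 1 \<Longrightarrow> elementary_block_in (k + \<theta>) a (a + \<delta>)"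
    and \<theta>: "0 \<le> \<theta>" "\<theta> \<le> 1" and "0 < \<delta>"
  shows "\<not> (3 * \<theta> + \<delta> \<le> 1 \<and> \<delta> \<le> 2 * \<theta>)"
    and "\<not> (2 + \<delta> \<le> 3 * \<theta> \<and> 2 * \<theta> + \<delta> \<le> 2)"
    and "\<not> (1 + \<delta> \<le> 3 * \<theta> \<and> 3 * \<theta> + \<delta> \<le> 2 \<and> \<delta> \<le> \<theta> \<and> \<theta> + \<delta> \<le> 1)"
proof -
  show "\<not> (3 * \<theta> + \<delta> \<le> 1 \<and> \<delta> \<le> 2 * \<theta>)"
  proof
    assume *: "3 * \<theta> + \<delta> \<le> 1 \<and> \<delta> \<le> 2 * \<theta>"
    have "elementary_pair k (3 * k)"
      by (rule elementary_block_inD[OF \<delta>[of "3 * \<theta>"]]) (use * \<theta> in auto)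
    moreover have "elementary_pair k (3 * k + 1)"
      by (rule elementary_block_inD[OF \<delta>[of \<theta>]]) (use * \<theta> \<open>0 < \<delta>\<close> in auto)
    ultimately show False
      by (rule not_elementary_pair_3_and_Suc)
  qed
  show "\<not> (2 + \<delta> \<le> 3 * \<theta> \<and> 2 * \<theta> + \<delta> \<le> 2)"
  proof
    assume *: "2 + \<delta> \<le> 3 * \<theta> \<and> 2 * \<theta> + \<delta> \<le> 2"
    have "elementary_pair (k + 1) (3 * (k + 1))"
      by (rule elementary_block_inD[OF \<delta>[of 0]]) (use * \<theta> \<open>0 < \<delta>\<close> in auto)
    moreover have "elementary_pair (k + 1) (3 * (k + 1) - 1)"
      by (rule elementary_block_inD[OF \<delta>[of "3 * \<theta> - 2"]]) (use * \<theta> \<open>0 < \<delta>\<close> in auto)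
    ultimately show False
      by (rule not_elementary_pair_3_and_pred)
  qed
  show "\<not> (1 + \<delta> \<le> 3 * \<theta> \<and> 3 * \<theta> + \<delta> \<le> 2 \<and> \<delta> \<le> \<theta> \<and> \<theta> + \<delta> \<le> 1)"
  proof
    assume *: "1 + \<delta> \<le> 3 * \<theta> \<and> 3 * \<theta> + \<delta> \<le> 2 \<and> \<delta> \<le> \<theta> \<and> \<theta> + \<delta> \<le> 1"
    have "elementary_pair k (3 * k + 1)"
      by (rule elementary_block_inD[OF \<delta>[of "1 - \<delta>"]]) (use * \<theta> \<open>0 < \<delta>\<close> in auto)
    moreover have "elementary_pair (k + 1) (3 * k + 2)"
      by (rule elementary_block_inD[OF \<delta>[of 0]]) (use * \<theta> \<open>0 < \<delta>\<close> in auto)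
    ultimately show False
      by (rule not_elementary_pair_consecutive)
  qed
qed

text \<open>The height of the orbit above the horizontal grid line that it crossed last, after the first integer horizontal distance
  that follows the crossing. In units of \<open>S\<close> this height lies in \<open>(0, 1)\<close> and, modulo \<open>1\<close>, it decreases by \<open>1 / S\<close> at each step.\<close>

definition slicing_phase :: "real \<Rightarrow> real \<Rightarrow> (nat \<Rightarrow> nat) \<Rightarrow> nat \<Rightarrow> real" where
  "slicing_phase S y \<xi> n = (y + S * real (\<Sum>i<n. \<xi> i) - real n) / S"

lemma slicing_phase_bounds:
  assumes "slicing_sequence S y \<xi>" "0 < S" "0 < y" "y < S"
  shows "0 < slicing_phase S y \<xi> n" "slicing_phase S y \<xi> n < 1"
proof -
  have "0 < y + S * real (\<Sum>i<n. \<xi> i) - real n \<and> y + S * real (\<Sum>i<n. \<xi> i) - real n < S"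
  proof (cases n)
    case 0
    with assms show ?thesis by simp
  next
    case (Suc N)
    have "y + S * real (\<Sum>i\<le>N. \<xi> i) \<in> {real N + 1 <..< real N + 1 + S}"
      using assms(1) unfolding slicing_sequence_def by blast
    then show ?thesis
      unfolding Suc lessThan_Suc_atMost by auto
  qed
  with \<open>0 < S\<close> show "0 < slicing_phase S y \<xi> n" "slicing_phase S y \<xi> n < 1"
    unfolding slicing_phase_def by (auto simp: divide_simps)
qed

lemma slicing_phase_eq:
  assumes "S \<noteq> 0"
  shows "slicing_phase S y \<xi> n = y / S + real (\<Sum>i<n. \<xi> i) - real n * (1 / S)"
  using assms unfolding slicing_phase_def by (simp add: field_simps)

lemma ternary_block_pair_size_mono:
  assumes "ternary_block \<Delta>"
  shows "pair_size (\<Delta> 0) \<le> pair_size (\<Delta> 1)" "pair_size (\<Delta> 1) \<le> pair_size (\<Delta> 2)"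
proof -
  obtain S y :: real where S: "0 < S" "S < 1"
    and *: "\<And>i. i \<le> 2 \<Longrightarrow> real i + 1 < y + S * real (pair_size (\<Delta> i)) \<and>
               y + S * real (pair_size (\<Delta> i)) < real i + 1 + S"
    using assms unfolding ternary_block_def by blast
  have "y + S * real (pair_size (\<Delta> 0)) < 1 + S" "2 < y + S * real (pair_size (\<Delta> 1))"
    "y + S * real (pair_size (\<Delta> 1)) < 2 + S" "3 < y + S * real (pair_size (\<Delta> 2))"
    using *[of 0] *[of 1] *[of 2] by auto
  then have "S * real (pair_size (\<Delta> 0)) < S * real (pair_size (\<Delta> 1))"
    "S * real (pair_size (\<Delta> 1)) < S * real (pair_size (\<Delta> 2))"
    using S by linarith+
  then show "pair_size (\<Delta> 0) \<le> pair_size (\<Delta> 1)" "pair_size (\<Delta> 1) \<le> pair_size (\<Delta> 2)"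
    using S by auto
qed

lemma elementary_block_imp_elementary_pair:
  assumes "elementary_block \<Delta>"
  shows "elementary_pair (int (pair_size (\<Delta> 0))) (int (pair_size (\<Delta> 2)))"
proof -
  obtain \<alpha> \<rho> \<alpha>' \<rho>' where *: "\<Delta> 0 = (\<alpha>, \<rho>)" "\<Delta> 2 = (\<alpha>', \<rho>')"
    by (meson surj_pair)
  have "\<forall>i\<le>2. snd (\<Delta> i) \<le> fst (\<Delta> i)"
    using assms unfolding elementary_block_def ternary_block_def by blast
  with * have "\<rho> \<le> \<alpha>" "\<rho>' \<le> \<alpha>'"
    by force+
  then have "tri_coords (int (pair_size (\<Delta> 0))) (int \<alpha> + 1) (int \<alpha> - 2 * int \<rho>)"
    "tri_coords (int (pair_size (\<Delta> 2))) (int \<alpha>' + 1) (int \<alpha>' - 2 * int \<rho>')"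
    unfolding * by (auto intro!: tri_coords_pair_size simp del: of_nat_add)
  moreover have "if even (int \<alpha> + 1 + (int \<alpha>' + 1)) then int \<alpha>' - 2 * int \<rho>' = int \<alpha> - 2 * int \<rho>
    else int \<alpha>' - 2 * int \<rho>' = 1 - (int \<alpha> - 2 * int \<rho>)"
    using assms unfolding elementary_block_def * Let_def by auto
  ultimately show ?thesis
    unfolding elementary_pair_def by blast
qed

text \<open>The link between the game and the rotation: wherever the rotation by \<open>-3 / S\<close>, started at a suitable point,
  meets the unit interval, the block read off there is elementary. The integer \<open>m\<close> is the
  sum of the slicing sequence up to that block, because the phase lies in \<open>(0, 1)\<close>.\<close>

lemma elementary_slopeE:
  assumes "elementary_slope S"
  obtains y where
    "\<And>a b (n::nat) (m::int). 0 \<le> a \<Longrightarrow> b \<le> 1 \<Longrightarrow> a \<le> y - real n * (3 / S) + m \<Longrightarrow>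
       y - real n * (3 / S) + m < b \<Longrightarrow> elementary_block_in (1 / S) a b"
proof -
  obtain \<Delta> y \<xi> where S: "0 < S" and \<Delta>: "\<And>n. elementary_block (\<Delta> n)" and y: "0 < y" "y < S"
    and sl: "slicing_sequence S y \<xi>" and \<xi>: "\<And>n i. i \<le> 2 \<Longrightarrow> \<xi> (3 * n + i) = block_chi (\<Delta> n) i"
    using assms unfolding elementary_slope_def elementary_sequence_def orbit_def by blast
  let ?z = "slicing_phase S y \<xi>"
  note z = slicing_phase_bounds[OF sl S y] and z_eq = slicing_phase_eq[of S y \<xi>]
  show thesis
  proof
    fix a b :: real and n :: nat and m :: int
    assume ab: "0 \<le> a" "b \<le> 1" and m: "a \<le> y / S - real n * (3 / S) + m" "y / S - real n * (3 / S) + m < b"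
    have "?z (3 * n) = y / S - real n * (3 / S) + (\<Sum>i<3*n. \<xi> i)"
      using S by (simp add: z_eq)
    moreover have "real_of_int (\<Sum>i<3*n. \<xi> i) < m + 1" "real_of_int m < (\<Sum>i<3*n. \<xi> i) + 1"
      using z[of "3 * n"] ab m calculation by auto
    then have "m = (\<Sum>i<3*n. \<xi> i)"
      by linarith
    ultimately have zn: "a \<le> ?z (3 * n)" "?z (3 * n) < b"
      using m by auto
    let ?c = "pair_size (\<Delta> n 0)" and ?s = "pair_size (\<Delta> n 2)"
    have mono: "?c \<le> pair_size (\<Delta> n 1)" "pair_size (\<Delta> n 1) \<le> ?s"
      using ternary_block_pair_size_mono \<Delta> unfolding elementary_block_def by blast+
    have c: "\<xi> (3 * n) = ?c"
      using \<xi>[of 0 n] by (simp add: block_chi_def)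
    have s: "\<xi> (3 * n) + \<xi> (3 * n + 1) + \<xi> (3 * n + 2) = ?s"
      using c \<xi>[of 1 n] \<xi>[of 2 n] mono by (simp add: block_chi_def numeral_2_eq_2)
    have "?z (3 * n + 1) = ?z (3 * n) - 1 / S + ?c"
      using S c by (simp add: z_eq add_divide_distrib)
    moreover have "?z (3 * n + 3) = ?z (3 * n) - 3 * (1 / S) + ?s"
    proof -
      have "(\<Sum>i<3*n+3. \<xi> i) = (\<Sum>i<3*n. \<xi> i) + ?s"
        using s by (simp add: numeral_3_eq_3 numeral_2_eq_2)
      then show ?thesis
        using S by (simp add: z_eq field_simps)
    qed
    ultimately show "elementary_block_in (1 / S) a b"
      unfolding elementary_block_in_def
      using zn z[of "3 * n"] z[of "3 * n + 1"] z[of "3 * n + 3"]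
        elementary_block_imp_elementary_pair[OF \<Delta>[of n]]
      by (intro exI[of _ "?z (3 * n)"] exI[of _ "int ?c"] exI[of _ "int ?s"]) auto
  qed
qed

section \<open>Rotations of the circle\<close>

lemma irrational_rotation_meets:
  fixes \<gamma> y a b :: real
  assumes "\<gamma> \<notin> \<rat>" "a < b"
  obtains n :: nat and m :: int where "a \<le> y - real n * \<gamma> + m" "y - real n * \<gamma> + m < b"
proof -
  obtain h k where k: "k > 0" "\<bar>of_int k * \<gamma> - of_int h - (y - (a + b) / 2)\<bar> < (b - a) / 2"
    using sequence_of_fractional_parts_is_dense[OF assms(1), of "(b - a) / 2" "y - (a + b) / 2"] assms(2)
    by (metis diff_gt_0_iff_gt half_gt_zero)
  have "real (nat k) = of_int k"
    using k by simp
  then show thesis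
    using that[of "nat k" h] k(2) by (simp add: abs_less_iff field_simps)
qed

text \<open>The multiples of \<open>w / p\<close> are, modulo \<open>1\<close>, exactly the multiples of \<open>gcd w p / p\<close>.\<close>

lemma rational_rotation_meets:
  fixes y a :: real and w :: int and p :: nat
  assumes "0 < p"
  obtains n :: nat and m :: int where "a \<le> y - real n * (w / p) + m" "y - real n * (w / p) + m < a + gcd w p / p"
proof -
  define g where "g = gcd w (int p)"
  have g: "0 < g"
    using assms unfolding g_def by (simp add: gcd_pos_int)
  \<comment> \<open>\<open>y + j * g / p\<close> is the first point of \<open>y + (g / p) \<int>\<close> that is not to the left of \<open>a\<close>.\<close>
  define j where "j = \<lceil>(a - y) * p / g\<rceil>"
  have j: "(a - y) * p \<le> j * g" "j * g < (a - y) * p + g"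
  proof -
    have "(a - y) * p / g \<le> j" "j < (a - y) * p / g + 1"
      unfolding j_def by linarith+
    then show "(a - y) * p \<le> j * g" "j * g < (a - y) * p + g"
      using g by (auto simp: field_simps)
  qed
  have "gcd w (int p) dvd - j * g"
    unfolding g_def by simp
  then obtain x where x: "[w * x = - j * g] (mod int p)"
    using cong_solve_dvd_int by blast
  \<comment> \<open>The rotation is only iterated forwards, hence the reduction to a nonnegative representative.\<close>
  define n where "n = nat (x mod int p)"
  have n: "int n = x mod int p"
    using assms unfolding n_def by simp
  have "[w * int n = - j * g] (mod int p)"
    using x unfolding n unique_euclidean_semiring_class.cong_def by (metis mod_mult_right_eq)
  then obtain m where "- j * g = w * int n + int p * m"
    by (meson cong_iff_lin)
  then have "real_of_int (- j * g) = real_of_int (w * int n + int p * m)"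
    by metis
  then have eq: "y - real n * (w / p) - m = y + j * g / p"
    using assms by (simp add: field_simps)
  have "a \<le> y + j * g / p" "y + j * g / p < a + g / p"
    using divide_right_mono[OF j(1), of "real p"] divide_strict_right_mono[OF j(2), of "real p"] assms
    by (auto simp: add_divide_distrib)
  then show thesis
    using that[of n "- m"] eq unfolding g_def by simp
qed

section \<open>Elementary slopes\<close>

lemma elementary_slope_rational:
  assumes "elementary_slope S"
  shows "S \<in> \<rat>"
proof (rule ccontr)
  assume irr: "S \<notin> \<rat>"
  obtain y where y:
    "\<And>a b (n::nat) (m::int). 0 \<le> a \<Longrightarrow> b \<le> 1 \<Longrightarrow> a \<le> y - real n * (3 / S) + m \<Longrightarrow>
       y - real n * (3 / S) + m < b \<Longrightarrow> elementary_block_in (1 / S) a b"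
    using elementary_slopeE[OF assms] by blast
  have "3 / S \<notin> \<rat>"
  proof
    assume "3 / S \<in> \<rat>"
    then have "3 / (3 / S) \<in> \<rat>"
      using Rats_divide[OF Rats_number_of] by blast
    with irr show False
      by (cases "S = 0") auto
  qed
  then have dense: "elementary_block_in (1 / S) a b" if "0 \<le> a" "b \<le> 1" "a < b" for a b
    using y[OF that(1,2)] irrational_rotation_meets[OF _ that(3)] by metis
  define \<theta> where "\<theta> = frac (1 / S)"
  have \<theta>: "0 \<le> \<theta>" "\<theta> \<le> 1" and eq: "1 / S = \<lfloor>1 / S\<rfloor> + \<theta>"
    using frac_ge_0[of "1 / S"] frac_lt_1[of "1 / S"] unfolding \<theta>_def by (auto simp: frac_def)
  have neq: "3 * \<theta> \<noteq> of_int i" for i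
  proof
    assume "3 * \<theta> = of_int i"
    then have "3 * (1 / S) = of_int (3 * \<lfloor>1 / S\<rfloor> + i)"
      using eq by simp
    then have "3 / S = of_int (3 * \<lfloor>1 / S\<rfloor> + i)"
      by simp
    then have "3 / S \<in> \<rat>"
      by (metis Rats_of_int)
    then show False
      using \<open>3 / S \<notin> \<rat>\<close> by blast
  qed
  \<comment> \<open>Up to positive factors the conditions of the gap lemma compare \<open>\<delta>\<close> with the distances from
    \<open>\<theta>\<close> to \<open>0\<close>, \<open>1/3\<close>, \<open>2/3\<close> and \<open>1\<close>, and this \<open>\<delta>\<close> is at most each of these distances.\<close>
  define \<delta> where "\<delta> = Min {\<bar>3 * \<theta>\<bar>, \<bar>3 * \<theta> - 1\<bar>, \<bar>3 * \<theta> - 2\<bar>, \<bar>3 * \<theta> - 3\<bar>} / 3"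
  have "0 < \<delta>"
    using neq[of 0] neq[of 1] neq[of 2] neq[of 3] unfolding \<delta>_def by auto
  have \<delta>: "3 * \<delta> \<le> \<bar>3 * \<theta>\<bar>" "3 * \<delta> \<le> \<bar>3 * \<theta> - 1\<bar>" "3 * \<delta> \<le> \<bar>3 * \<theta> - 2\<bar>" "3 * \<delta> \<le> \<bar>3 * \<theta> - 3\<bar>"
    unfolding \<delta>_def by auto
  have "elementary_block_in (\<lfloor>1 / S\<rfloor> + \<theta>) a (a + \<delta>)" if "0 \<le> a" "a + \<delta> \<le> 1" for a
    using dense[OF that] \<open>0 < \<delta>\<close> unfolding eq[symmetric] by simp
  note gaps = elementary_gaps[OF this \<theta> \<open>0 < \<delta>\<close>]
  consider "3 * \<theta> \<le> 1" | "1 \<le> 3 * \<theta>" "3 * \<theta> \<le> 2" | "2 \<le> 3 * \<theta>"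
    by linarith
  then show False
  proof cases
    case 1
    with gaps(1) \<delta>(1,2) \<theta> \<open>0 < \<delta>\<close> show False by linarith
  next
    case 2
    with gaps(3) \<delta>(2,3) \<theta> \<open>0 < \<delta>\<close> show False by linarith
  next
    case 3
    with gaps(2) \<delta>(3,4) \<theta> \<open>0 < \<delta>\<close> show False by linarith
  qed
qed

text \<open>Writing \<open>\<theta> = r / p\<close> with \<open>r = q mod p\<close>, the gap conditions become linear inequalities between the integers \<open>r\<close>, \<open>p\<close>
  and \<open>g = gcd 3 p\<close>. For \<open>g = 1\<close> they leave only \<open>r = 0\<close>, up to the values \<open>1/3\<close> and \<open>2/3\<close> of \<open>\<theta>\<close>, which
  need \<open>3\<close> to divide \<open>p\<close>. For \<open>g = 3\<close> and \<open>\<theta>\<close> away from these two values, they leave \<open>r = 1\<close> and \<open>r = p - 1\<close>, while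
  \<open>\<theta> = 1/3\<close> and \<open>\<theta> = 2/3\<close> mean \<open>p = 3\<close> because \<open>r\<close> and \<open>p\<close> are coprime.\<close>

lemma elementary_slope_fraction:
  fixes p q :: nat
  assumes "elementary_slope S" "0 < p" "coprime p q" "S = real p / real q"
  shows "p = 1 \<or> 3 dvd p \<and> (q mod p = 1 \<or> q mod p = p - 1)"
proof -
  obtain y where y:
    "\<And>a b (n::nat) (m::int). 0 \<le> a \<Longrightarrow> b \<le> 1 \<Longrightarrow> a \<le> y - real n * (3 / S) + m \<Longrightarrow>
       y - real n * (3 / S) + m < b \<Longrightarrow> elementary_block_in (1 / S) a b"
    using elementary_slopeE[OF assms(1)] by blast
  define g where "g = gcd 3 p"
  define r where "r = q mod p"
  have g: "gcd (3 * int q) (int p) = int g"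
    using assms(3) unfolding g_def
    by (metis gcd_int_int_eq gcd_mult_left_right_cancel of_nat_mult of_nat_numeral coprime_commute)
  have q: "q = (q div p) * p + r" "r < p"
    using assms(2) unfolding r_def by auto
  have "1 / S = q / p"
    using assms(2,4) by simp
  also have "\<dots> = int (q div p) + r / p"
    using assms(2) arg_cong[OF q(1), of real] by (simp add: field_simps)
  finally have S: "1 / S = int (q div p) + r / p" .
  have hits: "elementary_block_in (int (q div p) + r / p) a (a + g / p)" if a: "0 \<le> a" "a + g / p \<le> 1" for a
  proof -
    obtain n :: nat and m :: int where
      "a \<le> y - real n * ((3 * int q) / p) + m" "y - real n * ((3 * int q) / p) + m < a + gcd (3 * int q) p / p"
      using rational_rotation_meets[OF assms(2), of a y "3 * int q"] by metis
    then show ?thesis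
      using y[OF a, of n m] assms(4) unfolding g S by simp
  qed
  have "0 < g"
    unfolding g_def by simp
  then have "0 < real g / real p" "real r / real p \<le> 1"
    using assms(2) q(2) by auto
  note gaps = elementary_gaps[OF hits _ this(2,1), simplified]
  have scale: "real m / p \<le> real n / p" if "m \<le> n" for m n
    using that by (simp add: divide_right_mono)
  have c1: "\<not> (3 * r + g \<le> p \<and> g \<le> 2 * r)"
    using gaps(1) scale[of "3 * r + g" p] scale[of g "2 * r"] assms(2) by (auto simp: add_divide_distrib)
  have c2: "\<not> (2 * p + g \<le> 3 * r \<and> 2 * r + g \<le> 2 * p)"
    using gaps(2) scale[of "2 * p + g" "3 * r"] scale[of "2 * r + g" "2 * p"] assms(2) by (auto simp: add_divide_distrib)
  have c3: "\<not> (p + g \<le> 3 * r \<and> 3 * r + g \<le> 2 * p \<and> g \<le> r \<and> r + g \<le> p)"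
    using gaps(3) scale[of "p + g" "3 * r"] scale[of "3 * r + g" "2 * p"] scale[of g r] scale[of "r + g" p] assms(2)
    by (auto simp: add_divide_distrib)
  have "coprime r p"
    using assms(2,3) unfolding r_def by (simp add: coprime_commute)
  have one: "d = 1" if "d dvd r" "d dvd p" for d
    using \<open>coprime r p\<close> that by (meson coprime_common_divisor nat_dvd_1_iff_1)
  show ?thesis
  proof (cases "3 dvd p")
    case True
    then obtain m where m: "p = 3 * m"
      by (elim dvdE)
    have "g = 3"
      using True unfolding g_def by (simp add: gcd_proj1_iff)
    note c = c1[unfolded this m] c2[unfolded this m] c3[unfolded this m]
    have "r \<noteq> 0"
      using one[of p] m by (intro notI) simp
    have "m = 1" if "r = m \<or> r = 2 * m"
      using one[of m] that m by auto
    then have "r = 1 \<or> r = p - 1"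
    proof (cases "r < m \<or> 2 * m < r")
      case True
      with c(1,2) \<open>r \<noteq> 0\<close> q(2) show ?thesis
        unfolding m by linarith
    next
      case False
      have "\<not> (m < r \<and> r < 2 * m)"
        using c(3) by linarith
      then have "r = m \<or> r = 2 * m"
        using False by linarith
      with \<open>r = m \<or> r = 2 * m \<Longrightarrow> m = 1\<close> show ?thesis
        unfolding m by auto
    qed
    then show ?thesis
      using True unfolding r_def by simp
  next
    case False
    have "coprime 3 p"
      using False by (intro prime_imp_coprime) auto
    then have "g = 1"
      unfolding g_def by simp
    note c = c1[unfolded this] c2[unfolded this] c3[unfolded this]
    have "3 * r \<noteq> p" "3 * r \<noteq> 2 * p"
      using False by presburger+
    then have "r = 0"
      using c q(2) by linarith
    then show ?thesis
      using one[of p] by simp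
  qed
qed

theorem theorem3p1:
  fixes S :: real
  assumes "0 < S" and "S < 1" and "elementary_slope S"
  shows "S \<in> \<rat> \<and>
    (\<forall>p q :: nat. 0 < p \<and> 0 < q \<and> coprime p q \<and> S = real p / real q \<longrightarrow>
       (p = 1 \<or> 3 dvd p) \<and>
       (p \<noteq> 1 \<longrightarrow> [q = 1] (mod p) \<or> [q = p - 1] (mod p)))"
proof (intro conjI allI impI)
  show "S \<in> \<rat>"
    by (rule elementary_slope_rational[OF assms(3)])
next
  fix p q :: nat
  assume *: "0 < p \<and> 0 < q \<and> coprime p q \<and> S = real p / real q"
  then have disj: "p = 1 \<or> 3 dvd p \<and> (q mod p = 1 \<or> q mod p = p - 1)"
    using elementary_slope_fraction[OF assms(3)] by blast
  then show "p = 1 \<or> 3 dvd p"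
    by blast
  assume "p \<noteq> 1"
  with * disj show "[q = 1] (mod p) \<or> [q = p - 1] (mod p)"
    by (auto simp: unique_euclidean_semiring_class.cong_def)
qed

end
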